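(* Let $v$ be a cell of the $n\times n$ board on which an enemy knight stands, and let $k$ be the number of cells to which a knight on $v$ can move. In general, at least $\lceil k/2\rceil$ knights are needed to trap the enemy knight, and the enemy knight can always be trapped with $\lceil k/2\rceil$ knights. Small boards are treated separately: for $n=1$ and $n=2$ the enemy knight cannot move and is automatically trapped; for $n=3$, if the enemy knight is on the border then $2$ knights are needed to trap it, and if it is in the center it is automatically trapped.
   Context: Cells of the $n\times n$ board are $(x,y)$ with $1\le x,y\le n$; a cell is on the border if one of its coordinates is $1$ or $n$. A knight on $(x,y)$ attacks (can move to) $(x',y')$ when $\{|x-x'|,|y-y'|\}=\{1,2\}$. A set $T$ of cells not containing $v$ (the positions of the soldier knights) traps an enemy knight on $v$ if: (1) no two distinct cells of $T\cup\{v\}$ attack each other; and (2) every cell attacked from $v$ is attacked from some cell of $T$. The number of knights used is $|T|$. "Automatically trapped" means trapped with no soldier knights.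
   Formalization: The claim that the knight can always be trapped with ⌈k/2⌉ knights is stated for n ≥ 4 except for the four inner cells of the 4×4 board, where it is false: there k = 4 but at least 3 knights are needed. *)

theory Defs
  imports Complex_Main
begin

type_synonym cell = "int \<times> int"

definition board :: "nat \<Rightarrow> cell set" where
  "board n = {1..int n} \<times> {1..int n}"

definition border :: "nat \<Rightarrow> cell set" where
  "border n = {(x, y) \<in> board n. x \<in> {1, int n} \<or> y \<in> {1, int n}}"

definition attacks :: "cell \<Rightarrow> cell \<Rightarrow> bool" where
  "attacks c d \<longleftrightarrow> {\<bar>fst c - fst d\<bar>, \<bar>snd c - snd d\<bar>} = {1, 2}"

definition moves :: "nat \<Rightarrow> cell \<Rightarrow> cell set" where
  "moves n v = {w \<in> board n. attacks v w}"

definition traps :: "nat \<Rightarrow> cell set \<Rightarrow> cell \<Rightarrow> bool" where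
  "traps n T v \<longleftrightarrow>
     T \<subseteq> board n \<and> v \<notin> T \<and>
     (\<forall>c \<in> T \<union> {v}. \<forall>d \<in> T \<union> {v}. c \<noteq> d \<longrightarrow> \<not> attacks c d) \<and>
     (\<forall>w \<in> moves n v. \<exists>c \<in> T. attacks c w)"

definition automatically_trapped :: "nat \<Rightarrow> cell \<Rightarrow> bool" where
  "automatically_trapped n v \<longleftrightarrow> traps n {} v"

(* The four inner cells of the 4 x 4 board are genuine exceptions to the general rule that
   half of the number of moves, rounded up, is enough: there are four moves, but two soldier
   knights do not suffice. *)

lemma attacks_iff:
  "attacks (a, b) (c, d) \<longleftrightarrow>
     \<bar>a - c\<bar> = 1 \<and> \<bar>b - d\<bar> = 2 \<or> \<bar>a - c\<bar> = 2 \<and> \<bar>b - d\<bar> = 1"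
  by (auto simp: attacks_def doubleton_eq_iff)

lemma board_4: "board 4 = {1, 2, 3, 4} \<times> {1, 2, 3, 4}"
proof -
  have "{1..4} = {1, 2, 3, 4 :: int}"
    by (auto simp only: atLeastAtMost_iff insert_iff empty_iff)
  then show ?thesis
    by (simp add: board_def)
qed

lemma ball_board_4:
  "(\<forall>c \<in> board 4. P c) \<longleftrightarrow> (\<forall>x \<in> {1, 2, 3, 4}. \<forall>y \<in> {1, 2, 3, 4}. P (x, y))"
  unfolding board_4 by blast

lemma inner_4: "board 4 - border 4 = {(2, 2), (2, 3), (3, 2), (3, 3)}"
proof -
  have "\<forall>c \<in> board 4. c \<notin> border 4 \<longleftrightarrow> c \<in> {(2, 2), (2, 3), (3, 2), (3, 3)}"
    unfolding ball_board_4 by (simp add: border_def board_def)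
  moreover have "{(2, 2), (2, 3), (3, 2), (3, 3)} \<subseteq> board 4"
    by (simp add: board_def)
  ultimately show ?thesis
    by blast
qed

lemma moves_inner_4:
  "moves 4 (2, 2) = {(4, 1), (4, 3), (1, 4), (3, 4)}"
  "moves 4 (2, 3) = {(4, 4), (4, 2), (1, 1), (3, 1)}"
  "moves 4 (3, 2) = {(1, 1), (1, 3), (4, 4), (2, 4)}"
  "moves 4 (3, 3) = {(1, 4), (1, 2), (4, 1), (2, 1)}"
proof -
  have *: "moves 4 v = S" if "\<forall>w \<in> board 4. attacks v w \<longleftrightarrow> w \<in> S" "S \<subseteq> board 4" for v S
    using that unfolding moves_def by blast
  show "moves 4 (2, 2) = {(4, 1), (4, 3), (1, 4), (3, 4)}"
    by (rule *, unfold ball_board_4) (simp_all add: attacks_iff board_def)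
  show "moves 4 (2, 3) = {(4, 4), (4, 2), (1, 1), (3, 1)}"
    by (rule *, unfold ball_board_4) (simp_all add: attacks_iff board_def)
  show "moves 4 (3, 2) = {(1, 1), (1, 3), (4, 4), (2, 4)}"
    by (rule *, unfold ball_board_4) (simp_all add: attacks_iff board_def)
  show "moves 4 (3, 3) = {(1, 4), (1, 2), (4, 1), (2, 1)}"
    by (rule *, unfold ball_board_4) (simp_all add: attacks_iff board_def)
qed

lemma card_moves_inner_4:
  assumes "v \<in> board 4 - border 4"
  shows "card (moves 4 v) = 4"
proof -
  consider "v = (2, 2)" | "v = (2, 3)" | "v = (3, 2)" | "v = (3, 3)"
    using assms unfolding inner_4 by blast
  then show ?thesis
    by cases (simp_all add: moves_inner_4)
qed

lemma attackers_4:
  "\<forall>c \<in> board 4. attacks c (1, 1) \<longleftrightarrow> c \<in> {(2, 3), (3, 2)}"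
  "\<forall>c \<in> board 4. attacks c (4, 4) \<longleftrightarrow> c \<in> {(2, 3), (3, 2)}"
  "\<forall>c \<in> board 4. attacks c (1, 4) \<longleftrightarrow> c \<in> {(2, 2), (3, 3)}"
  "\<forall>c \<in> board 4. attacks c (4, 1) \<longleftrightarrow> c \<in> {(2, 2), (3, 3)}"
  "\<forall>c \<in> board 4. attacks c (1, 2) \<longleftrightarrow> c \<in> {(3, 3), (3, 1), (2, 4)}"
  "\<forall>c \<in> board 4. attacks c (2, 1) \<longleftrightarrow> c \<in> {(3, 3), (1, 3), (4, 2)}"
  "\<forall>c \<in> board 4. attacks c (1, 3) \<longleftrightarrow> c \<in> {(3, 2), (3, 4), (2, 1)}"
  "\<forall>c \<in> board 4. attacks c (3, 1) \<longleftrightarrow> c \<in> {(2, 3), (4, 3), (1, 2)}"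
  "\<forall>c \<in> board 4. attacks c (2, 4) \<longleftrightarrow> c \<in> {(3, 2), (1, 2), (4, 3)}"
  "\<forall>c \<in> board 4. attacks c (4, 2) \<longleftrightarrow> c \<in> {(2, 3), (2, 1), (3, 4)}"
  "\<forall>c \<in> board 4. attacks c (3, 4) \<longleftrightarrow> c \<in> {(2, 2), (1, 3), (4, 2)}"
  "\<forall>c \<in> board 4. attacks c (4, 3) \<longleftrightarrow> c \<in> {(2, 2), (2, 4), (3, 1)}"
  unfolding ball_board_4 by (simp_all add: attacks_iff)

lemma meets_three_disjoint_sets:
  assumes "finite T" "T \<inter> A \<noteq> {}" "T \<inter> B \<noteq> {}" "T \<inter> C \<noteq> {}"
    and "A \<inter> B = {}" "A \<inter> C = {}" "B \<inter> C = {}"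
  shows "3 \<le> card T"
proof -
  obtain a b c where *: "a \<in> T \<inter> A" "b \<in> T \<inter> B" "c \<in> T \<inter> C"
    using assms(2-4) by (metis ex_in_conv)
  then have "a \<noteq> b" "a \<noteq> c" "b \<noteq> c"
    using assms(5-7) by blast+
  then have "card {a, b, c} = 3"
    by simp
  moreover have "{a, b, c} \<subseteq> T"
    using * by blast
  ultimately show ?thesis
    using card_mono[OF assms(1), of "{a, b, c}"] by simp
qed

lemma three_needed_inner_4:
  assumes v: "v \<in> board 4 - border 4" and T: "traps 4 T v"
  shows "3 \<le> card T"
proof -
  have sub: "T \<subseteq> board 4" and notin: "v \<notin> T"
    and cov: "\<And>w. w \<in> moves 4 v \<Longrightarrow> \<exists>c \<in> T. attacks c w"
    using T by (auto simp: traps_def)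
  have fin: "finite T"
    using sub by (rule finite_subset) (simp add: board_4)
  have meets: "T \<inter> (A - {v}) \<noteq> {}"
    if "w \<in> moves 4 v" "\<forall>c \<in> board 4. attacks c w \<longleftrightarrow> c \<in> A" for w A
    using cov[OF that(1)] that(2) sub notin by blast
  consider "v = (2, 2)" | "v = (2, 3)" | "v = (3, 2)" | "v = (3, 3)"
    using v unfolding inner_4 by blast
  then show ?thesis
  proof cases
    case 1
    show ?thesis
      by (rule meets_three_disjoint_sets[OF fin
          meets[OF _ attackers_4(4)]
          meets[OF _ attackers_4(12)]
          meets[OF _ attackers_4(11)]])
        (simp_all add: 1 moves_inner_4)
  next
    case 2
    show ?thesis
      by (rule meets_three_disjoint_sets[OF fin
          meets[OF _ attackers_4(2)]
          meets[OF _ attackers_4(10)]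
          meets[OF _ attackers_4(8)]])
        (simp_all add: 2 moves_inner_4)
  next
    case 3
    show ?thesis
      by (rule meets_three_disjoint_sets[OF fin
          meets[OF _ attackers_4(1)]
          meets[OF _ attackers_4(7)]
          meets[OF _ attackers_4(9)]])
        (simp_all add: 3 moves_inner_4)
  next
    case 4
    show ?thesis
      by (rule meets_three_disjoint_sets[OF fin
          meets[OF _ attackers_4(3)]
          meets[OF _ attackers_4(5)]
          meets[OF _ attackers_4(6)]])
        (simp_all add: 4 moves_inner_4)
  qed
qed

end

theory Submission
  imports Defs
begin

text \<open>
  Lower bound: all cells attacked from a cell lie on a circle of radius \<open>sqrt 5\<close> around it,
  and two distinct circles meet in at most two points. So a soldier, standing elsewhere than the
  enemy, guards at most two of the \<open>k\<close> cells the enemy can move to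
  (\<open>common_targets_le_2\<close>), which forces \<open>k \<le> 2 * card T\<close>
  (\<open>card_moves_le_double\<close>).

  Upper bound: a knight's move changes the colour of the square. If all soldiers stand on the
  enemy's colour, then no two knights attack each other, and only the covering of the enemy's
  moves remains to be arranged (\<open>traps_same_colour\<close>). It can be arranged with as many soldiers
  as the lower bound permits by pairing the moves and placing one soldier for each pair, and one
  for the move left over if their number is odd. The symmetries of the square reduce this to
  cells \<open>(x, y)\<close> with \<open>x \<le> y\<close> in a quarter of the board (\<open>fundamental_domain\<close>), where only the
  distances to the two nearest sides matter, and only up to the third row. This leaves six pairings (\<open>efficient_trap_fundamental\<close>). The only board with
  \<open>n \<ge> 4\<close> on which one of the six does not fit is \<open>n = 4\<close>, for an inner cell.

  For \<open>n = 3\<close> a non-central cell has two moves, and no cell except the enemy's own attacks both,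
  so the lower bound rises from one to two.
\<close>

section \<open>Lower bound\<close>

lemma attacks_eq_targets:
  "attacks (x, y) w \<longleftrightarrow>
     w \<in> {(x + 1, y + 2), (x + 1, y - 2), (x - 1, y + 2), (x - 1, y - 2),
          (x + 2, y + 1), (x + 2, y - 1), (x - 2, y + 1), (x - 2, y - 1)}"
proof -
  have one: "\<bar>a - b\<bar> = 1 \<longleftrightarrow> b = a + 1 \<or> b = a - 1"
    and two: "\<bar>a - b\<bar> = 2 \<longleftrightarrow> b = a + 2 \<or> b = a - 2" for a b :: int
    by linarith+
  show ?thesis
    by (cases w) (simp only: attacks_iff one two insert_iff empty_iff prod.inject, blast)
qed

lemma moves_eq_targets:
  "moves n (x, y) = board n \<inter>
     {(x + 1, y + 2), (x + 1, y - 2), (x - 1, y + 2), (x - 1, y - 2),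
      (x + 2, y + 1), (x + 2, y - 1), (x - 2, y + 1), (x - 2, y - 1)}"
  using attacks_eq_targets unfolding moves_def by blast

lemma finite_board: "finite (board n)"
  by (simp add: board_def)

lemma finite_traps: "traps n T v \<Longrightarrow> finite T"
  unfolding traps_def using finite_board finite_subset by blast

lemma attacks_imp_distance: "attacks (a, b) (c, d) \<Longrightarrow> (c - a)\<^sup>2 + (d - b)\<^sup>2 = 5"
  by (auto simp: attacks_eq_targets)

lemma perp_to_same_imp_parallel:
  fixes s t d e :: int
  assumes "s * d + t * e = 0" "s' * d + t' * e = 0" "(d, e) \<noteq> (0, 0)"
  shows "s * t' = t * s'"
proof -
  have "d * (s * t' - t * s') = 0" "e * (s * t' - t * s') = 0"
    using assms(1,2) by algebra+
  then show ?thesis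
    using assms(3) by auto
qed

text \<open>
  By Lagrange's identity the squares of the cross product and of the scalar product add up to the
  product of the squared lengths.
\<close>

lemma parallel_perp_imp_zero:
  fixes s t s' t' :: int
  assumes "s * t' = t * s'" "s * s' + t * t' = 0"
  shows "(s, t) = (0, 0) \<or> (s', t') = (0, 0)"
proof -
  have "(s\<^sup>2 + t\<^sup>2) * (s'\<^sup>2 + t'\<^sup>2) = (s * t' - t * s')\<^sup>2 + (s * s' + t * t')\<^sup>2"
    by algebra
  then have "(s\<^sup>2 + t\<^sup>2) * (s'\<^sup>2 + t'\<^sup>2) = 0"
    using assms by simp
  then show ?thesis
    by (simp add: sum_power2_eq_zero_iff)
qed

text \<open>
  The point reflection in the midpoint of \<open>(a, b)\<close> and \<open>(c, d)\<close> exchanges the circles around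
  them, hence permutes their common points. So once \<open>(p, q)\<close> is common to both, its reflection
  is the only candidate for a second common point.
\<close>

lemma common_target_unique:
  assumes w: "attacks (a, b) (p, q)" "attacks (c, d) (p, q)"
    and w': "attacks (a, b) (p', q')" "attacks (c, d) (p', q')"
    and "(a, b) \<noteq> (c, d)"
  shows "(p', q') \<in> {(p, q), (a + c - p, b + d - q)}"
proof -
  note dist = w[THEN attacks_imp_distance] w'[THEN attacks_imp_distance]
  \<comment> \<open>The chord from \<open>w\<close> to \<open>w'\<close> and the segment from \<open>w\<close> to its reflection are both
      perpendicular to the line joining the centres.\<close>
  have chord: "(p' - p) * (c - a) + (q' - q) * (d - b) = 0"
  proof -
    have "2 * ((p' - p) * (c - a) + (q' - q) * (d - b)) =
        ((p' - a)\<^sup>2 + (q' - b)\<^sup>2) - ((p' - c)\<^sup>2 + (q' - d)\<^sup>2) -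
        (((p - a)\<^sup>2 + (q - b)\<^sup>2) - ((p - c)\<^sup>2 + (q - d)\<^sup>2))"
      by algebra
    also have "\<dots> = 0"
      unfolding dist by simp
    finally have "2 * ((p' - p) * (c - a) + (q' - q) * (d - b)) = 0" .
    then show ?thesis by simp
  qed
  have "(p' - (a + c - p)) * (c - a) + (q' - (b + d - q)) * (d - b) =
      (p' - p) * (c - a) + (q' - q) * (d - b) +
      ((p - a)\<^sup>2 + (q - b)\<^sup>2) - ((p - c)\<^sup>2 + (q - d)\<^sup>2)"
    by algebra
  also have "\<dots> = 0"
    unfolding dist chord by simp
  finally have perp: "(p' - (a + c - p)) * (c - a) + (q' - (b + d - q)) * (d - b) = 0" .
  have parallel: "(p' - p) * (q' - (b + d - q)) = (q' - q) * (p' - (a + c - p))"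
    using assms(5) by (intro perp_to_same_imp_parallel[OF chord perp]) auto
  \<comment> \<open>The triangle with vertices \<open>w\<close>, \<open>w'\<close> and the reflection of \<open>w\<close> would have a right angle
      at \<open>w'\<close>, so it is degenerate.\<close>
  have "(p' - p) * (p' - (a + c - p)) + (q' - q) * (q' - (b + d - q)) =
      ((p' - a)\<^sup>2 + (q' - b)\<^sup>2) - ((p - a)\<^sup>2 + (q - b)\<^sup>2) -
      ((p' - p) * (c - a) + (q' - q) * (d - b))"
    by algebra
  also have "\<dots> = 0"
    unfolding dist chord by simp
  finally have "(p' - p) * (p' - (a + c - p)) + (q' - q) * (q' - (b + d - q)) = 0" .
  then show ?thesis
    using parallel_perp_imp_zero[OF parallel] by auto
qed

lemma common_targets_le_2:
  assumes "c \<noteq> v"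
  shows "card {w. attacks c w \<and> attacks v w} \<le> 2"
proof (cases "{w. attacks c w \<and> attacks v w} = {}")
  case True
  then show ?thesis by (simp only: card.empty)
next
  case False
  then obtain w where w: "attacks c w" "attacks v w"
    by blast
  have "{w. attacks c w \<and> attacks v w} \<subseteq>
      {w, (fst c + fst v - fst w, snd c + snd v - snd w)}"
  proof
    fix w' assume "w' \<in> {w. attacks c w \<and> attacks v w}"
    then show "w' \<in> {w, (fst c + fst v - fst w, snd c + snd v - snd w)}"
      using common_target_unique[of "fst c" "snd c" "fst w" "snd w" "fst v" "snd v"
          "fst w'" "snd w'"] w assms
      by simp
  qed
  then have "card {w. attacks c w \<and> attacks v w} \<le>
      card {w, (fst c + fst v - fst w, snd c + snd v - snd w)}"
    by (intro card_mono) auto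
  also have "\<dots> \<le> 2"
    by (simp add: card_insert_if)
  finally show ?thesis .
qed

lemma card_moves_le_double:
  assumes "traps n T v"
  shows "card (moves n v) \<le> 2 * card T"
proof -
  have fin: "finite T"
    using assms by (rule finite_traps)
  have fin': "finite {w. attacks c w \<and> attacks v w}" for c
    by (rule finite_subset[of _ "{w. attacks v w}"]) (auto, cases v, simp add: attacks_eq_targets)
  have "moves n v \<subseteq> (\<Union>c\<in>T. {w. attacks c w \<and> attacks v w})"
    using assms unfolding traps_def moves_def by blast
  then have "card (moves n v) \<le> card (\<Union>c\<in>T. {w. attacks c w \<and> attacks v w})"
    using fin fin' by (intro card_mono) auto
  also have "\<dots> \<le> (\<Sum>c\<in>T. card {w. attacks c w \<and> attacks v w})"
    by (rule card_UN_le[OF fin])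
  also have "\<dots> \<le> (\<Sum>c\<in>T. 2)"
    using assms by (intro sum_mono common_targets_le_2) (auto simp: traps_def)
  finally show ?thesis
    by simp
qed

section \<open>Symmetries of the board\<close>

text \<open>
  Only self-inverse symmetries are considered: the two reflections generate the symmetry group of
  the square, and for an involution the transfer in one direction implies the converse.
\<close>

definition board_symmetry :: "nat \<Rightarrow> (cell \<Rightarrow> cell) \<Rightarrow> bool" where
  "board_symmetry n f \<longleftrightarrow>
     (\<forall>c. f (f c) = c) \<and>
     (\<forall>c. f c \<in> board n \<longleftrightarrow> c \<in> board n) \<and>
     (\<forall>c. f c \<in> border n \<longleftrightarrow> c \<in> border n) \<and>
     (\<forall>c d. attacks (f c) (f d) \<longleftrightarrow> attacks c d)"

text \<open>
  Lower bounds on the number of soldiers and the existence of small traps are both statements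
  about this set, so its invariance transfers them together.
\<close>

definition trap_sizes :: "nat \<Rightarrow> cell \<Rightarrow> nat set" where
  "trap_sizes n v = {m. \<exists>T. traps n T v \<and> card T = m}"

lemma board_symmetryD:
  assumes "board_symmetry n f"
  shows "f (f c) = c"
    and "f c \<in> board n \<longleftrightarrow> c \<in> board n"
    and "f c \<in> border n \<longleftrightarrow> c \<in> border n"
    and "attacks (f c) (f d) \<longleftrightarrow> attacks c d"
  using assms unfolding board_symmetry_def by blast+

lemma board_symmetry_swap: "board_symmetry n prod.swap"
proof -
  have "attacks (prod.swap c) (prod.swap d) \<longleftrightarrow> attacks c d" for c d
    by (simp add: attacks_def insert_commute)
  then show ?thesis
    by (auto simp: board_symmetry_def board_def border_def)
qed

lemma board_symmetry_flip: "board_symmetry n (\<lambda>(x, y). (int n + 1 - x, y))"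
proof -
  have "\<bar>int n + 1 - a - (int n + 1 - b)\<bar> = \<bar>a - b\<bar>" for a b
    by linarith
  then have "attacks (int n + 1 - a, b) (int n + 1 - c, d) \<longleftrightarrow> attacks (a, b) (c, d)" for a b c d
    by (simp only: attacks_def fst_conv snd_conv)
  moreover have "int n + 1 - x \<in> {1..int n} \<longleftrightarrow> x \<in> {1..int n}"
    and "int n + 1 - x \<in> {1, int n} \<longleftrightarrow> x \<in> {1, int n}" for x
    by auto
  ultimately show ?thesis
    unfolding board_symmetry_def board_def border_def
    by (simp only: split_paired_All mem_Times_iff fst_conv snd_conv case_prod_conv
        mem_Collect_eq diff_diff_eq2 add_diff_cancel_left') simp
qed

lemma inj_board_symmetry: "board_symmetry n f \<Longrightarrow> inj f"
  by (metis board_symmetryD(1) injI)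

lemma moves_symmetry:
  assumes "board_symmetry n f"
  shows "moves n (f v) = f ` moves n v"
proof
  show "f ` moves n v \<subseteq> moves n (f v)"
    using board_symmetryD[OF assms] unfolding moves_def by blast
  show "moves n (f v) \<subseteq> f ` moves n v"
  proof
    fix w assume "w \<in> moves n (f v)"
    then have "f w \<in> moves n v" "w = f (f w)"
      using board_symmetryD[OF assms] unfolding moves_def by (auto, metis)
    then show "w \<in> f ` moves n v" by blast
  qed
qed

lemma card_moves_symmetry:
  "board_symmetry n f \<Longrightarrow> card (moves n (f v)) = card (moves n v)"
  using moves_symmetry inj_board_symmetry by (metis card_image inj_on_subset subset_UNIV)

lemma traps_symmetry:
  assumes f: "board_symmetry n f" and T: "traps n T v"
  shows "traps n (f ` T) (f v)"
proof -
  note sym = board_symmetryD[OF f]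
  have inv: "f c = f d \<longleftrightarrow> c = d" for c d
    by (metis sym(1))
  show ?thesis
    using T unfolding traps_def moves_symmetry[OF f]
    by (simp add: inv sym subset_eq inj_image_mem_iff[OF inj_board_symmetry[OF f]])
qed

lemma trap_sizes_symmetry:
  assumes f: "board_symmetry n f"
  shows "trap_sizes n (f v) = trap_sizes n v"
proof -
  have sub: "trap_sizes n u \<subseteq> trap_sizes n (f u)" for u
  proof
    fix m assume "m \<in> trap_sizes n u"
    then obtain T where T: "traps n T u" "card T = m"
      by (auto simp: trap_sizes_def)
    have "card (f ` T) = card T"
      using inj_board_symmetry[OF f] by (metis card_image inj_on_subset subset_UNIV)
    then show "m \<in> trap_sizes n (f u)"
      using traps_symmetry[OF f T(1)] T(2) unfolding trap_sizes_def by blast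
  qed
  have "f (f v) = v"
    by (rule board_symmetryD(1)[OF f])
  then show ?thesis
    using sub[of v] sub[of "f v"] by auto
qed

lemma fundamental_domain:
  assumes "v \<in> board n"
    and inv: "\<And>f u. board_symmetry n f \<Longrightarrow> P (f u) \<Longrightarrow> P u"
    and dom: "\<And>x y. 1 \<le> x \<Longrightarrow> x \<le> y \<Longrightarrow> 2 * y \<le> int n + 1 \<Longrightarrow> P (x, y)"
  shows "P v"
proof -
  have swap: "P (y, x) \<Longrightarrow> P (x, y)" for x y
    using inv[OF board_symmetry_swap, of "(x, y)"] by simp
  have flip: "P (int n + 1 - x, y) \<Longrightarrow> P (x, y)" for x y
    using inv[OF board_symmetry_flip, of "(x, y)"] by simp
  have quarter: "P (x, y)" if "1 \<le> x" "2 * x \<le> int n + 1" "1 \<le> y" "2 * y \<le> int n + 1" for x y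
  proof (cases "x \<le> y")
    case True
    show ?thesis
      using that True by (intro dom)
  next
    case False
    show ?thesis
      using that False by (intro swap[OF dom]) simp_all
  qed
  have half: "P (x, y)" if "1 \<le> x" "x \<le> int n" "1 \<le> y" "2 * y \<le> int n + 1" for x y
  proof (cases "2 * x \<le> int n + 1")
    case True
    show ?thesis
      using that True by (intro quarter)
  next
    case False
    show ?thesis
      using that False by (intro flip[OF quarter]) simp_all
  qed
  have "P (x, y)" if "1 \<le> x" "x \<le> int n" "1 \<le> y" "y \<le> int n" for x y
  proof (cases "2 * y \<le> int n + 1")
    case True
    then show ?thesis
      using that by (intro half)
  next
    case False
    \<comment> \<open>Reflecting in the second coordinate is swapping, reflecting in the first, swapping back.\<close>
    have "P (x, int n + 1 - y)"
      using that False by (intro half) simp_all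
    then show ?thesis
      by (rule swap[OF flip[OF swap]])
  qed
  from this[of "fst v" "snd v"] show ?thesis
    using assms(1) by (simp add: board_def mem_Times_iff)
qed

section \<open>Traps that attain the lower bound\<close>

lemma attack_changes_colour:
  "attacks c d \<Longrightarrow> odd (fst c + snd c + fst d + snd d)"
proof (cases c, cases d)
  fix x y x' y'
  assume "attacks c d" "c = (x, y)" "d = (x', y')"
  then show ?thesis
    by (auto simp: attacks_eq_targets)
qed

lemma traps_same_colour:
  assumes "T \<subseteq> board n" "v \<notin> T"
    and colour: "\<forall>c\<in>T. even (fst c + snd c + fst v + snd v)"
    and "\<forall>w\<in>moves n v. \<exists>c\<in>T. attacks c w"
  shows "traps n T v"
proof -
  have "even (fst c + snd c + fst d + snd d)" if "c \<in> T \<union> {v}" "d \<in> T \<union> {v}" for c d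
  proof -
    have "even (fst c + snd c + fst v + snd v)" "even (fst d + snd d + fst v + snd v)"
      using that colour by auto
    then show ?thesis by presburger
  qed
  then have "\<not> attacks c d" if "c \<in> T \<union> {v}" "d \<in> T \<union> {v}" for c d
    using that attack_changes_colour by blast
  then show ?thesis
    using assms unfolding traps_def by blast
qed

lemma trap_size_le:
  assumes "T \<subseteq> board n" "v \<notin> T"
    and "\<forall>c\<in>T. even (fst c + snd c + fst v + snd v)"
    and "\<forall>w\<in>moves n v. \<exists>c\<in>T. attacks c w"
    and "M \<subseteq> moves n v" "2 * card T \<le> card M + 1"
  shows "\<exists>m\<in>trap_sizes n v. 2 * m \<le> card (moves n v) + 1"
proof -
  have "finite (moves n v)"
    using finite_board by (simp add: moves_def)
  then have "card M \<le> card (moves n v)"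
    using assms(5) by (rule card_mono)
  then show ?thesis
    using traps_same_colour[OF assms(1-4)] assms(6) unfolding trap_sizes_def by fastforce
qed

text \<open>
  In the interior the soldiers stand two cells away from the enemy in the four axis directions,
  and each guards two moves that are mirror images of each other in that axis. Near
  a side some of these four cells are off the board, and the moves left unguarded are paired anew
  so that the soldiers stand further inward. For the cell \<open>(1, 2)\<close>, which has three moves, the soldier on \<open>(1, 4)\<close> guards
  just one of them. The soldier on \<open>(5, 5)\<close> in the case of the cell \<open>(2, 2)\<close> is the one for which a
  board of side four is too small.
\<close>

lemma efficient_trap_fundamental:
  assumes "1 \<le> x" "x \<le> y" "2 * y \<le> int n + 1" "4 \<le> n" "n = 4 \<longrightarrow> (x, y) \<in> border n"
  shows "\<exists>m\<in>trap_sizes n (x, y). 2 * m \<le> card (moves n (x, y)) + 1"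
proof -
  have four: "n \<noteq> 4" if "x = 2" "y = 2"
    using assms(5) that by (auto simp: border_def)
  consider "x = 1" "y = 1" | "x = 1" "y = 2" | "x = 2" "y = 2"
    | "x = 1" "3 \<le> y" | "x = 2" "3 \<le> y" | "3 \<le> x"
    using assms(1,2) by linarith
  then show ?thesis
  proof cases
    case 1
    show ?thesis
      by (rule trap_size_le[where T = "{(4, 4)}" and M = "{(2, 3), (3, 2)}"])
        (use assms 1 in \<open>auto simp: moves_eq_targets board_def attacks_iff\<close>)
  next
    case 2
    show ?thesis
      by (rule trap_size_le[where T = "{(4, 3), (1, 4)}" and M = "{(2, 4), (3, 3), (3, 1)}"])
        (use assms 2 in \<open>auto simp: moves_eq_targets board_def attacks_iff\<close>)
  next
    case 3
    show ?thesis
      by (rule trap_size_le[where T = "{(3, 3), (5, 5)}"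
            and M = "{(3, 4), (1, 4), (4, 3), (4, 1)}"])
        (use assms 3 four in \<open>auto simp: moves_eq_targets board_def attacks_iff\<close>)
  next
    case 4
    show ?thesis
      by (rule trap_size_le[where T = "{(4, y + 1), (4, y - 1)}"
            and M = "{(2, y + 2), (2, y - 2), (3, y + 1), (3, y - 1)}"])
        (use assms 4 in \<open>auto simp: moves_eq_targets board_def attacks_iff\<close>)
  next
    case 5
    show ?thesis
      by (rule trap_size_le[where T = "{(4, y), (3, y + 1), (3, y - 1)}"
            and M = "{(3, y + 2), (3, y - 2), (1, y + 2), (1, y - 2), (4, y + 1), (4, y - 1)}"])
        (use assms 5 in \<open>auto simp: moves_eq_targets board_def attacks_iff\<close>)
  next
    case 6
    show ?thesis
      by (rule trap_size_le[where T = "{(x + 2, y), (x - 2, y), (x, y + 2), (x, y - 2)}"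
            and M = "{(x + 1, y + 2), (x + 1, y - 2), (x - 1, y + 2), (x - 1, y - 2),
                      (x + 2, y + 1), (x + 2, y - 1), (x - 2, y + 1), (x - 2, y - 1)}"])
        (use assms 6 in \<open>auto simp: moves_eq_targets board_def attacks_iff\<close>)
  qed
qed

lemma efficient_trap:
  assumes "v \<in> board n" "4 \<le> n" "n = 4 \<longrightarrow> v \<in> border n"
  shows "\<exists>m\<in>trap_sizes n v. 2 * m \<le> card (moves n v) + 1"
proof -
  have "(n = 4 \<longrightarrow> v \<in> border n) \<longrightarrow> (\<exists>m\<in>trap_sizes n v. 2 * m \<le> card (moves n v) + 1)"
    using assms(1)
  proof (rule fundamental_domain)
    fix f u
    assume f: "board_symmetry n f"
      and *: "(n = 4 \<longrightarrow> f u \<in> border n) \<longrightarrow>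
        (\<exists>m\<in>trap_sizes n (f u). 2 * m \<le> card (moves n (f u)) + 1)"
    have "f u \<in> border n \<longleftrightarrow> u \<in> border n"
      by (rule board_symmetryD(3)[OF f])
    then show "(n = 4 \<longrightarrow> u \<in> border n) \<longrightarrow>
        (\<exists>m\<in>trap_sizes n u. 2 * m \<le> card (moves n u) + 1)"
      using * unfolding trap_sizes_symmetry[OF f] card_moves_symmetry[OF f] by blast
  qed (use assms(2) efficient_trap_fundamental in blast)
  then show ?thesis
    using assms(3) by blast
qed

section \<open>Boards of side at most three\<close>

lemma automatically_trapped_iff: "v \<in> board n \<Longrightarrow> automatically_trapped n v \<longleftrightarrow> moves n v = {}"
  by (auto simp: automatically_trapped_def traps_def)

lemma no_moves_small:
  assumes "v \<in> board n" "n = 1 \<or> n = 2"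
  shows "moves n v = {}"
  using assms by (cases v) (auto simp: moves_eq_targets board_def attacks_iff)

lemma no_moves_centre_3: "moves 3 (2, 2) = {}"
  by (auto simp: moves_eq_targets board_def attacks_iff)

lemma two_needed:
  assumes T: "traps n T v" and w: "w \<in> moves n v" "w' \<in> moves n v"
    and no: "\<And>c. c \<in> board n \<Longrightarrow> attacks c w \<Longrightarrow> attacks c w' \<Longrightarrow> c = v"
  shows "2 \<le> card T"
proof -
  obtain c c' where c: "c \<in> T" "attacks c w" and c': "c' \<in> T" "attacks c' w'"
    using T w unfolding traps_def by blast
  have "c \<noteq> c'"
    using c c' no T unfolding traps_def by blast
  then show ?thesis
    using c(1) c'(1) card_mono[OF finite_traps[OF T], of "{c, c'}"] by simp
qed

lemma trap_sizes_border_3: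
  assumes "v \<in> border 3"
  shows "(\<forall>m\<in>trap_sizes 3 v. 2 \<le> m) \<and> 2 \<in> trap_sizes 3 v"
proof -
  have "v \<in> board 3"
    using assms by (auto simp: border_def)
  then have "v \<in> border 3 \<longrightarrow> (\<forall>m\<in>trap_sizes 3 v. 2 \<le> m) \<and> 2 \<in> trap_sizes 3 v"
  proof (rule fundamental_domain)
    fix f u
    assume f: "board_symmetry 3 f"
      and *: "f u \<in> border 3 \<longrightarrow> (\<forall>m\<in>trap_sizes 3 (f u). 2 \<le> m) \<and> 2 \<in> trap_sizes 3 (f u)"
    have "f u \<in> border 3 \<longleftrightarrow> u \<in> border 3"
      by (rule board_symmetryD(3)[OF f])
    then show "u \<in> border 3 \<longrightarrow> (\<forall>m\<in>trap_sizes 3 u. 2 \<le> m) \<and> 2 \<in> trap_sizes 3 u"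
      using * by (simp add: trap_sizes_symmetry[OF f])
  next
    fix x y :: int
    assume xy: "1 \<le> x" "x \<le> y" "2 * y \<le> int 3 + 1"
    show "(x, y) \<in> border 3 \<longrightarrow> (\<forall>m\<in>trap_sizes 3 (x, y). 2 \<le> m) \<and> 2 \<in> trap_sizes 3 (x, y)"
    proof
      assume "(x, y) \<in> border 3"
      then have "x = 1" "y = 1 \<or> y = 2"
        using xy by (auto simp: border_def)
      then consider "(x, y) = (1, 1)" | "(x, y) = (1, 2)"
        by auto
      then show "(\<forall>m\<in>trap_sizes 3 (x, y). 2 \<le> m) \<and> 2 \<in> trap_sizes 3 (x, y)"
      proof cases
        case 1
        have "traps 3 {(1, 3), (3, 1)} (1, 1)"
          by (rule traps_same_colour) (auto simp: moves_eq_targets board_def attacks_iff)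
        then have "2 \<in> trap_sizes 3 (1, 1)"
          unfolding trap_sizes_def by fastforce
        moreover have "2 \<le> card T" if "traps 3 T (1, 1)" for T
          by (rule two_needed[OF that, where w = "(2, 3)" and w' = "(3, 2)"])
            (auto simp: moves_eq_targets board_def attacks_iff)
        ultimately show ?thesis
          unfolding 1 trap_sizes_def by blast
      next
        case 2
        have "traps 3 {(2, 1), (2, 3)} (1, 2)"
          by (rule traps_same_colour) (auto simp: moves_eq_targets board_def attacks_iff)
        then have "2 \<in> trap_sizes 3 (1, 2)"
          unfolding trap_sizes_def by fastforce
        moreover have "2 \<le> card T" if "traps 3 T (1, 2)" for T
          by (rule two_needed[OF that, where w = "(3, 1)" and w' = "(3, 3)"])
            (auto simp: moves_eq_targets board_def attacks_iff)
        ultimately show ?thesis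
          unfolding 2 trap_sizes_def by blast
      qed
    qed
  qed
  then show ?thesis
    using assms by blast
qed

section \<open>The number of knights needed\<close>

theorem mainTheorem7:
  fixes n k :: nat and v :: cell
  assumes "v \<in> board n"
    and "k = card (moves n v)"
  shows "(\<forall>T. traps n T v \<longrightarrow> \<lceil>real k / 2\<rceil> \<le> int (card T)) \<and>
    (n \<ge> 4 \<and> \<not> (n = 4 \<and> v \<notin> border n) \<longrightarrow>
      (\<exists>T. traps n T v \<and> int (card T) = \<lceil>real k / 2\<rceil>)) \<and>
    (n = 1 \<or> n = 2 \<longrightarrow> moves n v = {} \<and> automatically_trapped n v) \<and>
    (n = 3 \<and> v \<in> border n \<longrightarrow>
      (\<forall>T. traps n T v \<longrightarrow> 2 \<le> card T) \<and> (\<exists>T. traps n T v \<and> card T = 2)) \<and>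
    (n = 3 \<and> v = (2, 2) \<longrightarrow> automatically_trapped n v)"
proof (intro conjI impI allI)
  have ceil: "\<lceil>real k / 2\<rceil> \<le> int m \<longleftrightarrow> k \<le> 2 * m" for m
    by (simp add: ceiling_le_iff) linarith
  show lower: "\<lceil>real k / 2\<rceil> \<le> int (card T)" if "traps n T v" for T
    using card_moves_le_double[OF that, folded assms(2)] by (simp only: ceil)
  show "\<exists>T. traps n T v \<and> int (card T) = \<lceil>real k / 2\<rceil>"
    if n: "4 \<le> n \<and> \<not> (n = 4 \<and> v \<notin> border n)"
  proof -
    obtain T where T: "traps n T v" "2 * card T \<le> k + 1"
      using efficient_trap[OF assms(1)] n unfolding assms(2) trap_sizes_def by blast
    then have "int (card T) = \<lceil>real k / 2\<rceil>"
      using lower[OF T(1)] by linarith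
    then show ?thesis
      using T(1) by blast
  qed
  show "moves n v = {}" "automatically_trapped n v" if "n = 1 \<or> n = 2"
    using no_moves_small[OF assms(1) that] automatically_trapped_iff[OF assms(1)] by simp_all
  show "2 \<le> card T" if "n = 3 \<and> v \<in> border n" "traps n T v" for T
    using trap_sizes_border_3[of v] that by (auto simp: trap_sizes_def)
  show "\<exists>T. traps n T v \<and> card T = 2" if "n = 3 \<and> v \<in> border n"
    using trap_sizes_border_3[of v] that by (auto simp: trap_sizes_def)
  show "automatically_trapped n v" if "n = 3 \<and> v = (2, 2)"
    using no_moves_centre_3 automatically_trapped_iff[OF assms(1)] that by simp
qed

end
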